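(* For every integer $m\ge 1$, the number of $(102,000)$-avoiding inversion sequences $e$ (of any length) with $\operatorname{dist}(e)=m$ and such that the maximum value $\max(e)$ occurs exactly once in $e$ (i.e. $|\{p: e_p=\max(e)\}|=1$) equals the $3$-Fuss–Catalan number $$\frac{1}{3m+1}\binom{4m}{m}.$$
   Context: An inversion sequence of length $n$ is an integer sequence $e=(e_1,\dots,e_n)$ with $0\le e_j\le j-1$ for all $j\in\{1,\dots,n\}$. The sequence $e$ contains the pattern $102$ if there are indices $i<j<k$ with $e_j<e_i<e_k$, and contains the pattern $000$ if there are indices $i<j<k$ with $e_i=e_j=e_k$; $e$ is $(102,000)$-avoiding if it contains neither pattern. $\operatorname{dist}(e)=|\{e_i:1\le i\le n\}|$ is the number of distinct entries of $e$, and $\max(e)$ is its largest entry. *)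

theory Defs
  imports Complex_Main
begin

(* Sequences are lists indexed from 0, so the entry e_j of the 1-based convention is e ! (j - 1)
   and the condition 0 <= e_j <= j - 1 becomes e ! i <= i. *)
definition inversion_sequence :: "nat list \<Rightarrow> bool" where
  "inversion_sequence e \<longleftrightarrow> (\<forall>i<length e. e ! i \<le> i)"

definition contains_102 :: "nat list \<Rightarrow> bool" where
  "contains_102 e \<longleftrightarrow>
     (\<exists>i j k. i < j \<and> j < k \<and> k < length e \<and> e ! j < e ! i \<and> e ! i < e ! k)"

definition contains_000 :: "nat list \<Rightarrow> bool" where
  "contains_000 e \<longleftrightarrow>
     (\<exists>i j k. i < j \<and> j < k \<and> k < length e \<and> e ! i = e ! j \<and> e ! j = e ! k)"

definition avoids_102_000 :: "nat list \<Rightarrow> bool" where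
  "avoids_102_000 e \<longleftrightarrow> \<not> contains_102 e \<and> \<not> contains_000 e"

definition dist_entries :: "nat list \<Rightarrow> nat" where
  "dist_entries e = card (set e)"

(* Only meaningful for nonempty e, since Max {} is unspecified. *)
definition max_entry :: "nat list \<Rightarrow> nat" where
  "max_entry e = Max (set e)"

end

theory Submission
  imports Defs "HOL-Library.Sublist"
begin

text \<open>
  In a 102-avoiding word the entries different from the maximum and preceding its last occurrence are
  weakly increasing. Hence every admissible word with \<open>m + 1\<close> distinct entries arises in a unique way
  from one with \<open>m\<close> distinct entries, \<open>e\<close>, by inserting a new maximum \<open>M\<close> at some position
  \<open>q\<close> with \<open>max e < M \<le> q \<le> \<ell>\<close>, where \<open>\<ell>\<close> is the length of the longest weakly increasing prefix
  of \<open>e\<close>, and possibly a second copy of \<open>M\<close> at a position \<open>r\<close> of \<open>e\<close> with \<open>q \<le> r \<le> \<ell>\<close>. The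
  possible choices depend only on the gap \<open>\<ell> - max e - 1\<close>, and the new gap is \<open>q - M\<close>, or
  \<open>q - M + 1\<close> if the two copies are adjacent. If \<open>T = 1 + x T\<^sup>4\<close>, then the number of words with
  \<open>m\<close> distinct entries and gap \<open>s\<close> is the coefficient of \<open>x\<^bsup>m-s\<^esup>\<close> in \<open>T\<^bsup>3s+1\<^esup>\<close>: these
  coefficients satisfy the same recurrence. Leaving out the second copy counts the words
  with a unique maximum by the coefficient of \<open>x\<^sup>m\<close> in \<open>T\<^sup>4\<close>, that is, of \<open>x\<^bsup>m+1\<^esup>\<close> in \<open>T\<close>.
\<close>

section \<open>Ballot numbers\<close>

text \<open>\<open>ballot n k\<close> is the coefficient of \<open>x\<^sup>n\<close> in \<open>T\<^sup>k\<close>; the recursion is \<open>T\<^bsup>k+1\<^esup> = T\<^sup>k + x T\<^bsup>k+4\<^esup>\<close>.\<close>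

fun ballot :: "nat \<Rightarrow> nat \<Rightarrow> nat" where
  "ballot 0 k = 1"
| "ballot (Suc n) 0 = 0"
| "ballot (Suc n) (Suc k) = ballot (Suc n) k + ballot n (k + 4)"

text \<open>This is the coefficient formula for \<open>T^k\<close>, kept free of division. Both
  recursive calls have the same value \<open>4 * n + k + 4\<close>, called \<open>N\<close> below,
  so they are expressed through \<open>N choose Suc n\<close> and \<open>N choose n\<close>, and
  Pascal's rule assembles the new binomial.\<close>

lemma ballot_closed_form: "(4 * n + k) * ballot n k = k * ((4 * n + k) choose n)"
proof (induction n k rule: ballot.induct)
  case (3 n k)
  define N where "N = 4 * n + k + 4"
  define X where "X = int (N choose Suc n)"
  define Y where "Y = int (N choose n)"
  have "Suc n * (N choose Suc n) = (N - n) * (N choose n)"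
    by (metis binomial_absorb_comp binomial_absorption)
  then have "int (Suc n) * X = int (N - n) * Y"
    unfolding X_def Y_def by (simp only: flip: of_nat_mult)
  then have XY: "int (Suc n) * X = (3 * int n + int k + 4) * Y"
    by (simp add: N_def)
  have 1: "int N * int (ballot (Suc n) k) = int k * X"
    using arg_cong[OF "3.IH"(1), of int] by (simp add: X_def N_def algebra_simps)
  have 2: "int N * int (ballot n (k + 4)) = (int k + 4) * Y"
    using arg_cong[OF "3.IH"(2), of int] by (simp add: Y_def N_def algebra_simps)
  have N: "int N = 4 * int n + int k + 4"
    by (simp add: N_def)
  \<comment> \<open>The extra factor \<open>N\<close> makes both induction hypotheses applicable.
    What remains besides the goal are two terms that cancel by \<open>XY\<close>; the subtraction is
    why the computation runs in the integers.\<close>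
  have "int N * ((int N + 1) * int (ballot (Suc n) (Suc k))) =
      (int N + 1) * (int N * int (ballot (Suc n) k) + int N * int (ballot n (k + 4)))"
    by (simp add: algebra_simps)
  also have "\<dots> = (int N + 1) * (int k * X + (int k + 4) * Y)"
    by (simp only: 1 2)
  also have "\<dots> = int N * ((int k + 1) * (X + Y)) - 4 * (int (Suc n) * X) + 4 * ((3 * int n + int k + 4) * Y)"
    unfolding N by (simp add: algebra_simps)
  also have "\<dots> = int N * ((int k + 1) * (X + Y))"
    unfolding XY by simp
  finally have "(int N + 1) * int (ballot (Suc n) (Suc k)) = (int k + 1) * (X + Y)"
    by (simp add: N_def)
  moreover have "int (Suc N choose Suc n) = X + Y"
    by (simp add: X_def Y_def)
  ultimately have "int (Suc N * ballot (Suc n) (Suc k)) = int (Suc k * (Suc N choose Suc n))"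
    by (simp only: of_nat_mult of_nat_Suc add.commute)
  then have "Suc N * ballot (Suc n) (Suc k) = Suc k * (Suc N choose Suc n)"
    by (simp only: of_nat_eq_iff)
  moreover have "4 * Suc n + Suc k = Suc N"
    by (simp add: N_def)
  ultimately show ?case
    by (simp only:)
qed simp_all

text \<open>Absorption turns \<open>(4 * m + 1) choose m\<close> from the closed form at
  \<open>k = 1\<close> into \<open>(4 * m) choose m\<close>, after which the common factor
  \<open>4 * m + 1\<close> cancels.\<close>

lemma ballot_one: "real (ballot m 1) = 1 / real (3 * m + 1) * real ((4 * m) choose m)"
proof -
  have "(4 * m + 1) * ballot m 1 = (4 * m + 1) choose m"
    using ballot_closed_form[of m 1] by simp
  moreover have "(4 * m + 1 - m) * ((4 * m + 1) choose m) = (4 * m + 1) * ((4 * m) choose m)"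
    using binomial_absorb_comp[of "4 * m + 1" m] by simp
  ultimately have "(4 * m + 1) * ((3 * m + 1) * ballot m 1) = (4 * m + 1) * ((4 * m) choose m)"
    by (simp add: algebra_simps)
  then have "(3 * m + 1) * ballot m 1 = (4 * m) choose m"
    by (simp only: mult_cancel1) simp
  then have "real (3 * m + 1) * real (ballot m 1) = real ((4 * m) choose m)"
    by (simp only: flip: of_nat_mult)
  then show ?thesis
    by (simp add: field_simps del: of_nat_add of_nat_mult)
qed

text \<open>The left side is the coefficient of \<open>x^n\<close> in
  \<open>T^k / (1 - x T^3)^(r+1)\<close>, and \<open>T = 1 + x T^4\<close> gives
  \<open>1 - x T^3 = 1 / T\<close>.\<close>

lemma sum_choose_ballot:
  "(\<Sum>j\<le>n. ((j + r) choose r) * ballot (n - j) (3 * j + k)) = ballot n (k + r + 1)"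
proof (induction r arbitrary: n k)
  case 0
  show ?case
  proof (induction n arbitrary: k)
    case (Suc n)
    \<comment> \<open>Splitting off \<open>j = 0\<close> leaves the sum for \<open>n\<close> with
      \<open>k + 3\<close>; the two parts are the two terms of the \<open>ballot\<close>
      recursion.\<close>
    from Suc[of "k + 3"] show ?case
      by (simp add: sum.atMost_Suc_shift add_ac del: sum.atMost_Suc)
  qed simp
next
  case (Suc r)
  note outer = this
  show ?case
  proof (induction n arbitrary: k)
    case (Suc n)
    \<comment> \<open>Pascal's rule separates a sum covered by the hypothesis on \<open>r\<close>
      from one whose \<open>j = 0\<close> term vanishes; shifting the latter leads to the hypothesis
      on \<open>n\<close>.\<close>
    have "(\<Sum>j\<le>Suc n. ((j + Suc r) choose Suc r) * ballot (Suc n - j) (3 * j + k)) =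
        (\<Sum>j\<le>Suc n. ((j + r) choose r) * ballot (Suc n - j) (3 * j + k)) +
        (\<Sum>j\<le>Suc n. ((j + r) choose Suc r) * ballot (Suc n - j) (3 * j + k))"
      by (simp add: algebra_simps sum.distrib del: sum.atMost_Suc)
    also have "(\<Sum>j\<le>Suc n. ((j + r) choose Suc r) * ballot (Suc n - j) (3 * j + k)) =
        (\<Sum>j\<le>n. ((j + Suc r) choose Suc r) * ballot (n - j) (3 * j + (k + 3)))"
      by (subst sum.atMost_Suc_shift) (simp add: add_ac del: sum.atMost_Suc binomial_Suc_Suc)
    also have "\<dots> = ballot n (k + 3 + Suc r + 1)"
      by (rule Suc)
    finally show ?case
      unfolding outer by (simp add: add_ac)
  qed simp
qed

section \<open>Summation over gaps\<close>

lemma sum_choose_ballot_from: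
  assumes "s \<le> m"
  shows "(\<Sum>g\<in>{s..m}. ((g - s + r) choose r) * ballot (m - g) (3 * g + k)) =
    ballot (m - s) (3 * s + k + r + 1)"
proof -
  have "(\<Sum>g\<in>{s..m}. ((g - s + r) choose r) * ballot (m - g) (3 * g + k)) =
      (\<Sum>j\<le>m - s. ((j + r) choose r) * ballot (m - s - j) (3 * j + (3 * s + k)))"
    by (rule sum.reindex_bij_witness[of _ "\<lambda>j. j + s" "\<lambda>g. g - s"])
      (use assms in \<open>auto simp: algebra_simps\<close>)
  then show ?thesis
    by (simp only: sum_choose_ballot add.assoc)
qed

lemma sum_Suc_atMost: "(\<Sum>i\<le>n. Suc i) = (n + 2) choose 2"
  by (induction n) (simp_all add: numeral_2_eq_2)

lemma sum_Suc_diff: "(\<Sum>s\<le>n::nat. Suc (n - s)) = (n + 2) choose 2"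
  using sum.nat_diff_reindex[of Suc "Suc n"] sum_Suc_atMost[of n]
  by (simp add: lessThan_Suc_atMost del: sum.lessThan_Suc sum.atMost_Suc)

lemma sum_swap_le:
  fixes F :: "nat \<Rightarrow> nat \<Rightarrow> nat"
  shows "(\<Sum>g\<le>m. \<Sum>s\<le>g. F g s) = (\<Sum>s\<le>m. \<Sum>g\<in>{s..m}. F g s)"
  unfolding sum.Sigma[OF finite_atMost ballI[OF finite_atMost]]
    sum.Sigma[OF finite_atMost ballI[OF finite_atLeastAtMost]]
  by (rule sum.reindex_bij_witness[of _ "\<lambda>(s, g). (g, s)" "\<lambda>(g, s). (s, g)"]) auto

text \<open>One generation of the tree: the inner sum is what the children of a word of gap
  \<open>g\<close> contribute to the total of \<open>h\<close>. Exchanging the sums and summing over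
  \<open>g\<close> produces the exponents \<open>3 * s + 4\<close> and \<open>3 * s + 3\<close>;
  after a shift in the second, \<open>x T^(3s+4) + T^(3s) = T^(3s+1)\<close> combines them.\<close>

lemma ballot_transfer:
  fixes h :: "nat \<Rightarrow> nat"
  shows "(\<Sum>g\<le>m. ballot (m - g) (3 * g + 1) *
           (\<Sum>s\<le>g. ((g - s + 2) choose 2) * h s + Suc (g - s) * h (Suc s))) =
         (\<Sum>s\<le>Suc m. ballot (Suc m - s) (3 * s + 1) * h s)"
proof -
  let ?A = "\<lambda>g. ballot (m - g) (3 * g + 1)"
  have "(\<Sum>g\<le>m. ?A g * (\<Sum>s\<le>g. ((g - s + 2) choose 2) * h s + Suc (g - s) * h (Suc s))) =
      (\<Sum>g\<le>m. \<Sum>s\<le>g. ((g - s + 2) choose 2) * ?A g * h s + ((g - s + 1) choose 1) * ?A g * h (Suc s))"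
    unfolding sum_distrib_left
    by (intro sum.cong refl) (simp only: choose_one distrib_left distrib_right ac_simps Suc_eq_plus1)
  also have "\<dots> = (\<Sum>s\<le>m. (\<Sum>g\<in>{s..m}. ((g - s + 2) choose 2) * ?A g) * h s +
      (\<Sum>g\<in>{s..m}. ((g - s + 1) choose 1) * ?A g) * h (Suc s))"
    unfolding sum_swap_le by (simp only: sum_distrib_right sum.distrib)
  also have "\<dots> = (\<Sum>s\<le>m. ballot (m - s) (3 * s + 4) * h s + ballot (m - s) (3 * s + 3) * h (Suc s))"
  proof (rule sum.cong[OF refl])
    fix s assume "s \<in> {..m}"
    then have s: "s \<le> m" by simp
    have "3 * s + 1 + 2 + 1 = 3 * s + 4" "3 * s + 1 + 1 + 1 = 3 * s + 3"
      by simp_all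
    then show "(\<Sum>g\<in>{s..m}. ((g - s + 2) choose 2) * ?A g) * h s +
        (\<Sum>g\<in>{s..m}. ((g - s + 1) choose 1) * ?A g) * h (Suc s) =
        ballot (m - s) (3 * s + 4) * h s + ballot (m - s) (3 * s + 3) * h (Suc s)"
      by (simp only: sum_choose_ballot_from[OF s])
  qed
  also have "\<dots> = (\<Sum>s\<le>m. ballot (m - s) (3 * s + 4) * h s) +
      (\<Sum>s\<le>m. ballot (m - s) (3 * s + 3) * h (Suc s))"
    by (rule sum.distrib)
  \<comment> \<open>The shift adds a term at \<open>s = 0\<close>, which vanishes since
    \<open>ballot (Suc m) 0 = 0\<close>.\<close>
  also have "(\<Sum>s\<le>m. ballot (m - s) (3 * s + 3) * h (Suc s)) =
      (\<Sum>s\<le>Suc m. ballot (Suc m - s) (3 * s) * h s)"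
    by (subst sum.atMost_Suc_shift) (simp add: add.commute)
  \<comment> \<open>This is the \<open>ballot\<close> recursion for \<open>s \<le> m\<close>; at
    \<open>s = Suc m\<close> both sides carry a ballot number with first argument \<open>0\<close>,
    which is \<open>1\<close>.\<close>
  also have "(\<Sum>s\<le>m. ballot (m - s) (3 * s + 4) * h s) + \<dots> =
      (\<Sum>s\<le>Suc m. ballot (Suc m - s) (3 * s + 1) * h s)"
    by (simp add: sum.distrib[symmetric] Suc_diff_le algebra_simps)
  finally show ?thesis .
qed

section \<open>Pattern containment\<close>

lemma subseq_set_mono: "subseq xs ys \<Longrightarrow> set xs \<subseteq> set ys"
  by (auto elim: list_emb_set)

lemma subseq_Cons_nth_iff:
  "subseq (a # as) e \<longleftrightarrow> (\<exists>i<length e. e ! i = a \<and> subseq as (drop (Suc i) e))"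
proof
  assume "subseq (a # as) e"
  then obtain us b vs where "e = us @ b # vs" "a = b" "subseq as vs"
    by (auto dest: list_emb_ConsD)
  then show "\<exists>i<length e. e ! i = a \<and> subseq as (drop (Suc i) e)"
    by (intro exI[of _ "length us"]) auto
next
  assume "\<exists>i<length e. e ! i = a \<and> subseq as (drop (Suc i) e)"
  then obtain i where i: "i < length e" "e ! i = a" "subseq as (drop (Suc i) e)"
    by blast
  then have "e = take i e @ a # drop (Suc i) e"
    using id_take_nth_drop[of i e] by simp
  moreover have "subseq (a # as) (take i e @ a # drop (Suc i) e)"
    using i(3) by (intro list_emb_append2 subseq_Cons2)
  ultimately show "subseq (a # as) e"
    by simp
qed

lemma subseq_pair_iff: "subseq [a, b] e \<longleftrightarrow> (\<exists>i j. i < j \<and> j < length e \<and> e ! i = a \<and> e ! j = b)"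
  (is "?L \<longleftrightarrow> ?R")
proof
  assume ?L
  then obtain i where i: "i < length e" "e ! i = a" "subseq [b] (drop (Suc i) e)"
    unfolding subseq_Cons_nth_iff[of a] by blast
  then obtain j where "j < length (drop (Suc i) e)" "drop (Suc i) e ! j = b"
    unfolding subseq_singleton_left in_set_conv_nth by blast
  with i show ?R
    by (intro exI[of _ i] exI[of _ "Suc i + j"]) simp
next
  assume ?R
  then obtain i j where *: "i < j" "j < length e" "e ! i = a" "e ! j = b"
    by blast
  then have "b \<in> set (drop (Suc i) e)"
    unfolding in_set_conv_nth by (intro exI[of _ "j - Suc i"]) auto
  with * show ?L
    unfolding subseq_Cons_nth_iff[of a] subseq_singleton_left by (intro exI[of _ i]) simp
qed

lemma subseq_triple_iff:
  "subseq [a, b, c] e \<longleftrightarrow>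
     (\<exists>i j k. i < j \<and> j < k \<and> k < length e \<and> e ! i = a \<and> e ! j = b \<and> e ! k = c)"
  (is "?L \<longleftrightarrow> ?R")
proof
  assume ?L
  then obtain i where i: "i < length e" "e ! i = a" "subseq [b, c] (drop (Suc i) e)"
    unfolding subseq_Cons_nth_iff[of a] by blast
  then obtain j k where "j < k" "k < length (drop (Suc i) e)"
    "drop (Suc i) e ! j = b" "drop (Suc i) e ! k = c"
    unfolding subseq_pair_iff by blast
  with i show ?R
    by (intro exI[of _ i] exI[of _ "Suc i + j"] exI[of _ "Suc i + k"]) simp
next
  assume ?R
  then obtain i j k where *: "i < j" "j < k" "k < length e" "e ! i = a" "e ! j = b" "e ! k = c"
    by blast
  then have "subseq [b, c] (drop (Suc i) e)"
    unfolding subseq_pair_iff by (intro exI[of _ "j - Suc i"] exI[of _ "k - Suc i"]) auto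
  with * show ?L
    unfolding subseq_Cons_nth_iff[of a] by (intro exI[of _ i]) simp
qed

text \<open>Subwords split along \<open>@\<close>, so the effect of inserting a letter becomes a
  case distinction on how the pattern is cut.\<close>

lemma contains_102_iff_subseq:
  "contains_102 e \<longleftrightarrow> (\<exists>a b c. a < b \<and> b < c \<and> subseq [b, a, c] e)"
proof
  assume "contains_102 e"
  then obtain i j k where "i < j" "j < k" "k < length e" "e ! j < e ! i" "e ! i < e ! k"
    unfolding contains_102_def by blast
  then show "\<exists>a b c. a < b \<and> b < c \<and> subseq [b, a, c] e"
    unfolding subseq_triple_iff by (intro exI[of _ "e ! j"] exI[of _ "e ! i"] exI[of _ "e ! k"]) blast
next
  assume "\<exists>a b c. a < b \<and> b < c \<and> subseq [b, a, c] e"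
  then obtain a b c i j k where "a < b" "b < c" "i < j" "j < k" "k < length e"
    "e ! i = b" "e ! j = a" "e ! k = c"
    unfolding subseq_triple_iff by (elim exE conjE)
  then show "contains_102 e"
    unfolding contains_102_def by (intro exI[of _ i] exI[of _ j] exI[of _ k]) simp
qed

lemma subseq_replicate_iff: "subseq (replicate n x) e \<longleftrightarrow> n \<le> count_list e x"
proof (induction e arbitrary: n)
  case Nil
  show ?case by (cases n) simp_all
next
  case (Cons y e)
  show ?case
  proof (cases n)
    case (Suc k)
    then show ?thesis
      using Cons.IH[of k] Cons.IH[of n] by (cases "x = y") (simp_all add: subseq_Cons2_iff)
  qed simp
qed

lemma contains_000_iff_count: "contains_000 e \<longleftrightarrow> (\<exists>x. 3 \<le> count_list e x)"
proof -
  have "subseq [x, x, x] e \<longleftrightarrow> 3 \<le> count_list e x" for x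
    using subseq_replicate_iff[of 3 x e] by (simp add: numeral_3_eq_3)
  then have "(\<exists>x. 3 \<le> count_list e x) \<longleftrightarrow>
      (\<exists>x i j k. i < j \<and> j < k \<and> k < length e \<and> e ! i = x \<and> e ! j = x \<and> e ! k = x)"
    by (simp only: flip: subseq_triple_iff)
  also have "\<dots> \<longleftrightarrow> contains_000 e"
  proof
    assume "contains_000 e"
    then obtain i j k where "i < j" "j < k" "k < length e" "e ! i = e ! j" "e ! j = e ! k"
      unfolding contains_000_def by (elim exE conjE)
    then show "\<exists>x i j k. i < j \<and> j < k \<and> k < length e \<and> e ! i = x \<and> e ! j = x \<and> e ! k = x"
      by (intro exI[of _ "e ! k"] exI[of _ i] exI[of _ j] exI[of _ k]) simp
  next
    assume "\<exists>x i j k. i < j \<and> j < k \<and> k < length e \<and> e ! i = x \<and> e ! j = x \<and> e ! k = x"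
    then obtain x i j k where "i < j" "j < k" "k < length e" "e ! i = x" "e ! j = x" "e ! k = x"
      by (elim exE conjE)
    then show "contains_000 e"
      unfolding contains_000_def by (intro exI[of _ i] exI[of _ j] exI[of _ k]) simp
  qed
  finally show ?thesis
    by (rule sym)
qed

lemma sorted_iff_subseq: "sorted e \<longleftrightarrow> (\<forall>a b. subseq [b, a] e \<longrightarrow> b \<le> a)"
  for e :: "nat list"
proof
  assume "sorted e"
  then show "\<forall>a b. subseq [b, a] e \<longrightarrow> b \<le> a"
    unfolding subseq_pair_iff sorted_iff_nth_mono_less by auto
next
  assume *: "\<forall>a b. subseq [b, a] e \<longrightarrow> b \<le> a"
  show "sorted e"
    unfolding sorted_iff_nth_mono_less
  proof (intro allI impI)
    fix i j assume "i < j" "j < length e"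
    then have "subseq [e ! i, e ! j] e"
      unfolding subseq_pair_iff by (intro exI[of _ i] exI[of _ j]) simp
    with * show "e ! i \<le> e ! j"
      by simp
  qed
qed

text \<open>The inserted letter can only play the role of 2, so what becomes forbidden is a descent
  among smaller letters before it. The bound is weak so that the lemma also covers a second copy of
  the maximum; the filter discards a copy already in \<open>u\<close>.\<close>

lemma contains_102_insert_max:
  assumes le: "\<And>x. x \<in> set (u @ v) \<Longrightarrow> x \<le> M"
  shows "contains_102 (u @ M # v) \<longleftrightarrow> contains_102 (u @ v) \<or> \<not> sorted (filter (\<lambda>x. x < M) u)"
proof
  assume "contains_102 (u @ M # v)"
  then obtain a b c where abc: "a < b" "b < c" "subseq [b, a, c] (u @ M # v)"
    unfolding contains_102_iff_subseq by (elim exE conjE)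
  from abc(3) obtain p q where pq: "[b, a, c] = p @ q" "subseq p u" "subseq q (M # v)"
    unfolding subseq_append_iff by (elim exE conjE)
  show "contains_102 (u @ v) \<or> \<not> sorted (filter (\<lambda>x. x < M) u)"
  proof (cases "subseq q v")
    case True
    have "subseq [b, a, c] (u @ v)"
      unfolding pq(1) by (rule list_emb_append_mono[OF pq(2) True])
    with abc show ?thesis
      unfolding contains_102_iff_subseq by (intro disjI1 exI conjI)
  next
    case False
    \<comment> \<open>\<open>q\<close> embeds in \<open>M # v\<close> but not in \<open>v\<close>,
      so its first letter is matched with the inserted \<open>M\<close>.\<close>
    obtain q' where q': "q = M # q'" "subseq q' v"
    proof (cases q)
      case Nil
      with False show ?thesis by simp
    next
      case (Cons y ys)
      with pq(3) False that show ?thesis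
        by (cases "y = M") simp_all
    qed
    have *: "x \<le> M" if "x \<in> set p \<union> set q'" for x
      using le[of x] that subseq_set_mono[OF pq(2)] subseq_set_mono[OF q'(2)] by auto
    \<comment> \<open>With \<open>M\<close> as the first or middle letter of the pattern, another
      pattern letter would exceed \<open>M\<close>, against \<open>*\<close>.\<close>
    consider "p = []" "b = M" "q' = [a, c]" | "p = [b]" "a = M" | "p = [b, a]" "c = M"
      using pq(1) unfolding q'(1) by (auto simp: Cons_eq_append_conv)
    then have p: "p = [b, a]" and c: "c = M"
      using abc(1,2) *[of b] *[of c] by (cases; simp)+
    have "subseq (filter (\<lambda>x. x < M) [b, a]) (filter (\<lambda>x. x < M) u)"
      using pq(2) unfolding p by (rule subseq_filter)
    then have "subseq [b, a] (filter (\<lambda>x. x < M) u)"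
      using abc(1,2) c by simp
    with abc(1) have "\<not> sorted (filter (\<lambda>x. x < M) u)"
      unfolding sorted_iff_subseq by (meson not_le)
    then show ?thesis ..
  qed
next
  assume "contains_102 (u @ v) \<or> \<not> sorted (filter (\<lambda>x. x < M) u)"
  then show "contains_102 (u @ M # v)"
  proof
    assume "contains_102 (u @ v)"
    then obtain a b c where abc: "a < b" "b < c" "subseq [b, a, c] (u @ v)"
      unfolding contains_102_iff_subseq by (elim exE conjE)
    have "subseq (u @ v) (u @ M # v)"
      unfolding subseq_append' by (rule list_emb_Cons) (rule subseq_order.refl)
    then have "subseq [b, a, c] (u @ M # v)"
      by (rule subseq_order.trans[OF abc(3)])
    with abc(1,2) show ?thesis
      unfolding contains_102_iff_subseq by (intro exI conjI)
  next
    assume "\<not> sorted (filter (\<lambda>x. x < M) u)"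
    then obtain a b where ab: "\<not> b \<le> a" "subseq [b, a] (filter (\<lambda>x. x < M) u)"
      unfolding sorted_iff_subseq by blast
    have "b < M"
      using subseq_set_mono[OF ab(2)] by simp
    have "subseq ([b, a] @ [M]) (u @ M # v)"
      by (rule list_emb_append_mono[OF subseq_order.trans[OF ab(2) subseq_filter_left]]) simp
    then have "subseq [b, a, M] (u @ M # v)"
      by simp
    with ab(1) \<open>b < M\<close> show ?thesis
      unfolding contains_102_iff_subseq not_le by (intro exI conjI)
  qed
qed

lemma inversion_sequence_append_iff:
  "inversion_sequence (u @ v) \<longleftrightarrow>
     inversion_sequence u \<and> (\<forall>i<length v. v ! i \<le> length u + i)"
proof
  assume *: "inversion_sequence (u @ v)"
  have "v ! i \<le> length u + i" if "i < length v" for i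
    using *[unfolded inversion_sequence_def, rule_format, of "length u + i"] that by simp
  moreover have "u ! i \<le> i" if "i < length u" for i
    using *[unfolded inversion_sequence_def, rule_format, of i] that by (simp add: nth_append)
  ultimately show "inversion_sequence u \<and> (\<forall>i<length v. v ! i \<le> length u + i)"
    unfolding inversion_sequence_def by blast
next
  assume *: "inversion_sequence u \<and> (\<forall>i<length v. v ! i \<le> length u + i)"
  have "(u @ v) ! i \<le> i" if "i < length (u @ v)" for i
  proof (cases "i < length u")
    case True
    with * show ?thesis
      by (simp add: inversion_sequence_def nth_append)
  next
    case False
    with that have "i - length u < length v"
      by simp
    with * have "v ! (i - length u) \<le> length u + (i - length u)"
      by blast
    with False show ?thesis
      by (simp add: nth_append)
  qed
  then show "inversion_sequence (u @ v)"
    by (simp add: inversion_sequence_def)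
qed

lemma inversion_sequence_append_small:
  assumes "\<And>x. x \<in> set v \<Longrightarrow> x \<le> length u"
  shows "inversion_sequence (u @ v) \<longleftrightarrow> inversion_sequence u"
proof -
  have "v ! i \<le> length u + i" if "i < length v" for i
    using assms[OF nth_mem[OF that]] by simp
  then show ?thesis
    by (simp add: inversion_sequence_append_iff)
qed

text \<open>Once \<open>M\<close> fits, the entries of \<open>v\<close> are at most
  \<open>M\<close>, hence at most \<open>length u\<close>, so shifting \<open>v\<close> by one
  position affects no condition.\<close>

lemma inversion_sequence_insert_max:
  assumes "\<And>x. x \<in> set v \<Longrightarrow> x \<le> M"
  shows "inversion_sequence (u @ M # v) \<longleftrightarrow> inversion_sequence (u @ v) \<and> M \<le> length u"
proof (cases "M \<le> length u")
  case True
  with assms have "x \<le> length u" if "x \<in> set v" for x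
    using that order_trans by blast
  with True inversion_sequence_append_small[of "M # v" u] inversion_sequence_append_small[of v u]
  show ?thesis
    by auto
next
  case False
  then show ?thesis
    by (auto simp: inversion_sequence_append_iff)
qed

section \<open>Admissible words and insertion of a new maximum\<close>

definition admissible :: "nat list \<Rightarrow> bool" where
  "admissible e \<longleftrightarrow> inversion_sequence e \<and> avoids_102_000 e"

lemma admissible_iff:
  "admissible e \<longleftrightarrow> inversion_sequence e \<and> \<not> contains_102 e \<and> (\<forall>x. count_list e x \<le> 2)"
proof -
  have "\<not> 3 \<le> c \<longleftrightarrow> c \<le> 2" for c :: nat
    by auto
  then show ?thesis
    by (simp add: admissible_def avoids_102_000_def contains_000_iff_count)
qed

lemma filter_less_id:
  assumes "\<And>x. x \<in> set u \<Longrightarrow> x < M"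
  shows "filter (\<lambda>x. x < M) u = u"
  using assms by (simp add: filter_id_conv)

lemma admissible_insert_one:
  assumes less: "\<And>x. x \<in> set (u @ v) \<Longrightarrow> x < (M :: nat)"
  shows "admissible (u @ M # v) \<longleftrightarrow> admissible (u @ v) \<and> sorted u \<and> M \<le> length u"
proof -
  have le: "x \<le> M" if "x \<in> set (u @ v)" for x
    using less[OF that] by simp
  have "M \<notin> set (u @ v)"
    using less by blast
  then have "count_list (u @ v) M = 0"
    unfolding count_list_0_iff .
  then have "count_list (u @ M # v) x \<le> 2 \<longleftrightarrow> count_list (u @ v) x \<le> 2" for x
    by (cases "x = M") simp_all
  moreover have "filter (\<lambda>x. x < M) u = u"
    using less by (intro filter_less_id) simp
  then have "contains_102 (u @ M # v) \<longleftrightarrow> contains_102 (u @ v) \<or> \<not> sorted u"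
    using contains_102_insert_max[OF le] by simp
  moreover have "inversion_sequence (u @ M # v) \<longleftrightarrow> inversion_sequence (u @ v) \<and> M \<le> length u"
    using le by (intro inversion_sequence_insert_max) simp
  ultimately show ?thesis
    unfolding admissible_iff by (simp only: conj_ac de_Morgan_disj not_not)
qed

text \<open>The copies are treated in turn. The second requires \<open>u @ v\<close> to be sorted,
  which covers the requirement of the first; the position bound of the first copy implies that of
  the second.\<close>

lemma admissible_insert_two:
  assumes less: "\<And>x. x \<in> set (u @ v @ w) \<Longrightarrow> x < (M :: nat)"
  shows "admissible (u @ M # v @ M # w) \<longleftrightarrow>
    admissible (u @ v @ w) \<and> sorted (u @ v) \<and> M \<le> length u"
proof -
  have less': "x < M" if "x \<in> set u \<or> x \<in> set v \<or> x \<in> set w" for x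
    using that by (intro less) simp
  have le: "x \<le> M" if "x = M \<or> x \<in> set u \<or> x \<in> set v \<or> x \<in> set w" for x
    using that less'[of x] by linarith
  have "M \<notin> set (u @ v @ w)"
    using less by blast
  then have "count_list (u @ v @ w) M = 0"
    unfolding count_list_0_iff .
  then have "count_list (u @ M # v @ M # w) x \<le> 2 \<longleftrightarrow> count_list (u @ v @ w) x \<le> 2" for x
    by (cases "x = M") simp_all
  moreover have "contains_102 (u @ M # v @ M # w) \<longleftrightarrow> contains_102 (u @ v @ w) \<or> \<not> sorted (u @ v)"
  proof -
    have f: "filter (\<lambda>x. x < M) u = u" "filter (\<lambda>x. x < M) v = v"
      using less' by (auto intro: filter_less_id)
    have "contains_102 ((u @ M # v) @ M # w) \<longleftrightarrow>
        contains_102 ((u @ M # v) @ w) \<or> \<not> sorted (filter (\<lambda>x. x < M) (u @ M # v))"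
      by (rule contains_102_insert_max) (rule le, auto)
    moreover have "contains_102 (u @ M # (v @ w)) \<longleftrightarrow>
        contains_102 (u @ v @ w) \<or> \<not> sorted (filter (\<lambda>x. x < M) u)"
      by (rule contains_102_insert_max) (rule le, auto)
    moreover have "sorted (u @ v) \<Longrightarrow> sorted u"
      by (simp add: sorted_append)
    ultimately show ?thesis
      by (simp add: f) blast
  qed
  moreover have "inversion_sequence (u @ M # v @ M # w) \<longleftrightarrow>
      inversion_sequence (u @ v @ w) \<and> M \<le> length u"
  proof -
    have "inversion_sequence (u @ M # (v @ M # w)) \<longleftrightarrow>
        inversion_sequence (u @ (v @ M # w)) \<and> M \<le> length u"
      by (rule inversion_sequence_insert_max) (rule le, auto)
    moreover have "inversion_sequence ((u @ v) @ M # w) \<longleftrightarrow>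
        inversion_sequence ((u @ v) @ w) \<and> M \<le> length (u @ v)"
      by (rule inversion_sequence_insert_max) (rule le, auto)
    ultimately show ?thesis
      by auto
  qed
  ultimately show ?thesis
    unfolding admissible_iff by (simp only: conj_ac de_Morgan_disj not_not)
qed

section \<open>The generating tree\<close>

definition rise :: "nat list \<Rightarrow> nat" where
  "rise e = Max {q. q \<le> length e \<and> sorted (take q e)}"

text \<open>Shifted by one from the maximum, so that the empty word starts the tree with gap \<open>0\<close>.\<close>

definition bound :: "nat list \<Rightarrow> nat" where
  "bound e = Max (insert 0 (Suc ` set e))"

text \<open>Prefixes of sorted lists are sorted, so the lengths collected in \<open>rise\<close>
  form an initial segment, determined by its maximum.\<close>

lemma le_rise_iff: "q \<le> rise e \<longleftrightarrow> q \<le> length e \<and> sorted (take q e)"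
proof -
  let ?S = "{q. q \<le> length e \<and> sorted (take q e)}"
  have fin: "finite ?S"
    by (rule finite_subset[of _ "{..length e}"]) auto
  have "0 \<in> ?S"
    by simp
  with fin have "rise e \<in> ?S"
    unfolding rise_def by (intro Max_in) blast+
  moreover have "q \<le> rise e" if "q \<in> ?S"
    unfolding rise_def using fin that by (rule Max_ge)
  moreover have "take q e = take q (take (rise e) e)" if "q \<le> rise e"
    using that by (simp add: min_absorb1)
  ultimately show ?thesis
    by (metis (no_types, lifting) le_trans mem_Collect_eq sorted_wrt_take)
qed

lemma rise_append:
  assumes "sorted u" "v = [] \<or> \<not> sorted (u @ [hd v])"
  shows "rise (u @ v) = length u"
proof (rule antisym)
  show "length u \<le> rise (u @ v)"
    using assms by (simp add: le_rise_iff)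
  have "\<not> Suc (length u) \<le> rise (u @ v)"
    using assms by (cases v) (simp_all add: le_rise_iff)
  then show "rise (u @ v) \<le> length u"
    by simp
qed

lemma rise_insert_one:
  assumes "sorted u" "\<And>x. x \<in> set (u @ v) \<Longrightarrow> x < M"
  shows "rise (u @ M # v) = Suc (length u)"
proof -
  have "sorted (u @ [M])"
    using assms by (auto simp: sorted_append intro: less_imp_le)
  moreover have "v = [] \<or> \<not> M \<le> hd v"
    using assms(2)[of "hd v"] by (cases v) simp_all
  then have "v = [] \<or> \<not> sorted ((u @ [M]) @ [hd v])"
    by (auto simp: sorted_append)
  ultimately show ?thesis
    using rise_append[of "u @ [M]" v] by simp
qed

text \<open>A smaller letter right after \<open>M\<close> is a descent, so the increasing prefix
  ends with the first copy unless the second is adjacent.\<close>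

lemma rise_insert_two:
  assumes "sorted u" "\<And>x. x \<in> set (u @ v @ w) \<Longrightarrow> x < M"
  shows "rise (u @ M # v @ M # w) = (if v = [] then Suc (Suc (length u)) else Suc (length u))"
proof (cases v)
  case Nil
  have "sorted (u @ [M, M])"
    using assms by (auto simp: sorted_append intro: less_imp_le)
  moreover have "w = [] \<or> \<not> M \<le> hd w"
    using assms(2)[of "hd w"] by (cases w) simp_all
  then have "w = [] \<or> \<not> sorted ((u @ [M, M]) @ [hd w])"
    by (auto simp: sorted_append)
  ultimately show ?thesis
    using rise_append[of "u @ [M, M]" w] Nil by simp
next
  case (Cons x xs)
  have "sorted (u @ [M])"
    using assms by (auto simp: sorted_append intro: less_imp_le)
  moreover have "\<not> M \<le> x"
    using assms(2)[of x] by (simp add: Cons)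
  then have "\<not> sorted ((u @ [M]) @ [x])"
    by (simp add: sorted_append)
  ultimately show ?thesis
    using rise_append[of "u @ [M]" "v @ M # w"] Cons by simp
qed

lemma bound_le_iff: "bound e \<le> M \<longleftrightarrow> (\<forall>x\<in>set e. x < M)"
  by (simp add: bound_def less_eq_Suc_le)

lemma bound_eq:
  assumes "M \<in> set e" "\<And>x. x \<in> set e \<Longrightarrow> x \<le> M"
  shows "bound e = Suc M"
proof (rule antisym)
  show "bound e \<le> Suc M"
    using assms(2) by (simp add: bound_le_iff less_Suc_eq_le)
  have "\<not> bound e \<le> M"
    using assms(1) by (auto simp: bound_le_iff)
  then show "Suc M \<le> bound e"
    by simp
qed

text \<open>The subtraction is exact on admissible words, by \<open>bound_le_rise\<close>.\<close>

definition gap :: "nat list \<Rightarrow> nat" where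
  "gap e = rise e - bound e"

text \<open>The inequalities say in turn that \<open>M\<close> is a new maximum, that it obeys the
  inversion condition at position \<open>q\<close>, and that the letters before it increase
  weakly.\<close>

definition slots :: "nat list \<Rightarrow> (nat \<times> nat) set" where
  "slots e = {(q, M). bound e \<le> M \<and> M \<le> q \<and> q \<le> rise e}"

definition admissible_dist :: "nat \<Rightarrow> nat list set" where
  "admissible_dist m = {e. admissible e \<and> card (set e) = m}"

text \<open>Both \<open>q\<close> and \<open>r\<close> are positions in the original \<open>e\<close>; for \<open>r = q\<close> the two copies are adjacent.\<close>

definition insert_one :: "nat list \<times> nat \<times> nat \<Rightarrow> nat list" where
  "insert_one = (\<lambda>(e, q, M). take q e @ M # drop q e)"

definition insert_two :: "nat list \<times> (nat \<times> nat) \<times> nat \<Rightarrow> nat list" where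
  "insert_two = (\<lambda>(e, (q, M), r). take q e @ M # drop q (take r e) @ M # drop r e)"

section \<open>Shape and gap of the words created by insertion\<close>

lemma slots_split:
  assumes "(q, M) \<in> slots e"
  obtains u v where "e = u @ v" "length u = q" "sorted u" "M \<le> q"
    "\<forall>x\<in>set (u @ v). x < M" "insert_one (e, q, M) = u @ M # v"
proof
  show "e = take q e @ drop q e"
    by simp
  show "length (take q e) = q" "sorted (take q e)" "M \<le> q"
    "\<forall>x\<in>set (take q e @ drop q e). x < M"
    using assms by (auto simp: slots_def le_rise_iff bound_le_iff)
  show "insert_one (e, q, M) = take q e @ M # drop q e"
    by (simp add: insert_one_def)
qed

lemma slots_split_two:
  assumes "(q, M) \<in> slots e" "r \<in> {q..rise e}"
  obtains u v w where "e = u @ v @ w" "length u = q" "length (u @ v) = r" "sorted (u @ v)" "M \<le> q"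
    "\<forall>x\<in>set (u @ v @ w). x < M" "insert_two (e, (q, M), r) = u @ M # v @ M # w"
proof
  have uv: "take q e @ drop q (take r e) = take r e"
    using assms(2) append_take_drop_id[of q "take r e"] by (simp add: min_absorb1)
  show e: "e = take q e @ drop q (take r e) @ drop r e"
    using uv by (metis append.assoc append_take_drop_id)
  show "length (take q e) = q" "M \<le> q"
    using assms by (auto simp: slots_def le_rise_iff)
  show "length (take q e @ drop q (take r e)) = r" "sorted (take q e @ drop q (take r e))"
    unfolding uv using assms by (auto simp: le_rise_iff)
  show "\<forall>x\<in>set (take q e @ drop q (take r e) @ drop r e). x < M"
    using assms(1) unfolding e[symmetric] by (auto simp: slots_def bound_le_iff)
  show "insert_two (e, (q, M), r) = take q e @ M # drop q (take r e) @ M # drop r e"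
    by (simp add: insert_two_def)
qed

text \<open>The new word has bound \<open>Suc M\<close> and rise \<open>Suc q\<close>. The second
  claim keeps the subtraction in \<open>gap\<close> exact in the next generation.\<close>

lemma gap_insert_one:
  assumes "(q, M) \<in> slots e"
  shows "gap (insert_one (e, q, M)) = q - M" "bound (insert_one (e, q, M)) \<le> rise (insert_one (e, q, M))"
proof -
  obtain u v where *: "e = u @ v" "length u = q" "sorted u" "M \<le> q"
    "\<forall>x\<in>set (u @ v). x < M" "insert_one (e, q, M) = u @ M # v"
    using slots_split[OF assms] by metis
  have "bound (u @ M # v) = Suc M"
    using *(5) by (intro bound_eq) (auto intro: less_imp_le)
  moreover have "rise (u @ M # v) = Suc q"
    using *(2,3,5) rise_insert_one by blast
  ultimately show "gap (insert_one (e, q, M)) = q - M"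
    "bound (insert_one (e, q, M)) \<le> rise (insert_one (e, q, M))"
    using *(4,6) by (simp_all add: gap_def)
qed

lemma gap_insert_two:
  assumes "(q, M) \<in> slots e" "r \<in> {q..rise e}"
  shows "gap (insert_two (e, (q, M), r)) = (if r = q then Suc (q - M) else q - M)"
    "bound (insert_two (e, (q, M), r)) \<le> rise (insert_two (e, (q, M), r))"
proof -
  obtain u v w where *: "e = u @ v @ w" "length u = q" "length (u @ v) = r" "sorted (u @ v)" "M \<le> q"
    "\<forall>x\<in>set (u @ v @ w). x < M" "insert_two (e, (q, M), r) = u @ M # v @ M # w"
    using slots_split_two[OF assms] by metis
  have "bound (u @ M # v @ M # w) = Suc M"
    using *(6) by (intro bound_eq) (auto intro: less_imp_le)
  moreover have "rise (u @ M # v @ M # w) = (if r = q then Suc (Suc q) else Suc q)"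
    using rise_insert_two[of u v w M] *(2,3,4,6) by (auto simp: sorted_append)
  ultimately show "gap (insert_two (e, (q, M), r)) = (if r = q then Suc (q - M) else q - M)"
    "bound (insert_two (e, (q, M), r)) \<le> rise (insert_two (e, (q, M), r))"
    using *(5,7) by (simp_all add: gap_def Suc_diff_le)
qed

section \<open>Bijections between insertion data and words of the next level\<close>

lemma Max_insert_one:
  assumes "\<And>x. x \<in> set (u @ v) \<Longrightarrow> x < (M :: nat)"
  shows "Max (set (u @ M # v)) = M"
  using assms by (intro Max_eqI) (auto intro: less_imp_le)

lemma Max_insert_two:
  assumes "\<And>x. x \<in> set (u @ v @ w) \<Longrightarrow> x < (M :: nat)"
  shows "Max (set (u @ M # v @ M # w)) = M"
  using assms by (intro Max_eqI) (auto intro: less_imp_le)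

lemma append_Cons_unique:
  assumes "x \<notin> set u" "x \<notin> set u'"
  shows "u @ x # v = u' @ x # v' \<longleftrightarrow> u = u' \<and> v = v'"
  using assms
proof (induction u arbitrary: u')
  case Nil
  then show ?case by (cases u') auto
next
  case (Cons y u)
  then show ?case by (cases u') auto
qed

text \<open>The inverse deletes the unique maximum: \<open>M\<close> is recovered as
  \<open>Max\<close> and \<open>q\<close> as its position, and \<open>admissible_insert_one\<close>
  shows that what remains is admissible with a valid slot.\<close>

lemma bij_betw_insert_one:
  "bij_betw insert_one (SIGMA e:admissible_dist m. slots e)
     {e \<in> admissible_dist (Suc m). count_list e (Max (set e)) = 1}"
  unfolding bij_betw_def
proof (intro conjI equalityI subsetI)
  show "inj_on insert_one (SIGMA e:admissible_dist m. slots e)"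
  proof (rule inj_onI)
    fix x x'
    assume mem: "x \<in> (SIGMA e:admissible_dist m. slots e)" "x' \<in> (SIGMA e:admissible_dist m. slots e)"
      and "insert_one x = insert_one x'"
    moreover obtain e q M e' q' M' where x: "x = (e, q, M)" "x' = (e', q', M')"
      by (metis prod.exhaust)
    ultimately have eq: "insert_one (e, q, M) = insert_one (e', q', M')"
      by simp
    from mem x have "(q, M) \<in> slots e" "(q', M') \<in> slots e'"
      by simp_all
    then obtain u v u' v' where
      1: "e = u @ v" "length u = q" "\<forall>x\<in>set (u @ v). x < M" "insert_one (e, q, M) = u @ M # v"
      and 2: "e' = u' @ v'" "length u' = q'" "\<forall>x\<in>set (u' @ v'). x < M'"
        "insert_one (e', q', M') = u' @ M' # v'"
      by (metis slots_split)
    have eq': "u @ M # v = u' @ M' # v'"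
      using eq unfolding 1(4) 2(4) .
    have "Max (set (u @ M # v)) = M" "Max (set (u' @ M' # v')) = M'"
      by (intro Max_insert_one 1(3)[rule_format] 2(3)[rule_format]; assumption)+
    with eq' have M: "M' = M"
      by simp
    have "M \<notin> set u" "M \<notin> set u'"
      using 1(3) 2(3) by (auto simp: M)
    with eq' have "u = u'" "v = v'"
      unfolding M by (simp_all add: append_Cons_unique)
    with 1 2 M show "x = x'"
      by (simp add: x)
  qed
next
  fix f assume "f \<in> insert_one ` (SIGMA e:admissible_dist m. slots e)"
  then obtain e q M where e: "e \<in> admissible_dist m" and s: "(q, M) \<in> slots e" and f: "f = insert_one (e, q, M)"
    by auto
  obtain u v where *: "e = u @ v" "length u = q" "sorted u" "M \<le> q"
    "\<forall>x\<in>set (u @ v). x < M" "insert_one (e, q, M) = u @ M # v"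
    using slots_split[OF s] by metis
  have M: "M \<notin> set (u @ v)"
    using *(5) by blast
  have less: "x < M" if "x \<in> set (u @ v)" for x
    using *(5) that by blast
  have adm: "admissible (u @ M # v) \<longleftrightarrow> admissible (u @ v) \<and> sorted u \<and> M \<le> length u"
    by (rule admissible_insert_one) (rule less)
  have Max: "Max (set (u @ M # v)) = M"
    by (rule Max_insert_one) (rule less)
  have "admissible f"
    unfolding f *(6) adm using e *(1-4) by (simp add: admissible_dist_def)
  moreover have "card (set f) = Suc m"
    unfolding f *(6) using e M by (simp add: *(1) admissible_dist_def)
  moreover have "count_list f (Max (set f)) = 1"
    unfolding f *(6) Max using M by (simp add: count_list_0_iff)
  ultimately show "f \<in> {e \<in> admissible_dist (Suc m). count_list e (Max (set e)) = 1}"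
    by (simp add: admissible_dist_def)
next
  fix f assume *: "f \<in> {e \<in> admissible_dist (Suc m). count_list e (Max (set e)) = 1}"
  define M where "M = Max (set f)"
  have count: "count_list f M = 1"
    using * by (simp add: M_def)
  have "f \<noteq> []"
    using * by (auto simp: admissible_dist_def)
  then have "M \<in> set f" and le: "\<And>x. x \<in> set f \<Longrightarrow> x \<le> M"
    by (simp_all add: M_def)
  then obtain u v where f: "f = u @ M # v"
    by (auto dest: split_list)
  have "count_list (u @ v) M = 0"
    using count by (simp add: f)
  then have M: "M \<notin> set (u @ v)"
    unfolding count_list_0_iff .
  have less: "x < M" if "x \<in> set (u @ v)" for x
    using le[of x] that M by (cases "x = M") (auto simp: f)
  have adm: "admissible (u @ v)" "sorted u" "M \<le> length u"
    using admissible_insert_one[OF less] * by (simp_all add: f admissible_dist_def)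
  have "card (set (u @ v)) = m"
    using * M by (simp add: f admissible_dist_def)
  with adm have "u @ v \<in> admissible_dist m"
    by (simp add: admissible_dist_def)
  moreover have "(length u, M) \<in> slots (u @ v)"
    using adm less by (auto simp: slots_def le_rise_iff bound_le_iff)
  moreover have "f = insert_one (u @ v, length u, M)"
    by (simp add: f insert_one_def)
  ultimately show "f \<in> insert_one ` (SIGMA e:admissible_dist m. slots e)"
    by blast
qed

text \<open>Both copies of the maximum are deleted. Neither \<open>u\<close> nor \<open>v\<close>
  contains \<open>M\<close>, so uniqueness of the splitting, used twice, recovers \<open>q\<close>
  and \<open>r\<close>.\<close>

lemma bij_betw_insert_two:
  "bij_betw insert_two (SIGMA e:admissible_dist m. SIGMA s:slots e. {fst s..rise e})
     {e \<in> admissible_dist (Suc m). count_list e (Max (set e)) = 2}"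
  unfolding bij_betw_def
proof (intro conjI equalityI subsetI)
  show "inj_on insert_two (SIGMA e:admissible_dist m. SIGMA s:slots e. {fst s..rise e})"
  proof (rule inj_onI)
    fix x x'
    assume mem: "x \<in> (SIGMA e:admissible_dist m. SIGMA s:slots e. {fst s..rise e})"
      "x' \<in> (SIGMA e:admissible_dist m. SIGMA s:slots e. {fst s..rise e})"
      and "insert_two x = insert_two x'"
    moreover obtain e q M r e' q' M' r' where x: "x = (e, (q, M), r)" "x' = (e', (q', M'), r')"
      by (metis prod.exhaust)
    ultimately have eq: "insert_two (e, (q, M), r) = insert_two (e', (q', M'), r')"
      by simp
    from mem x have s: "(q, M) \<in> slots e" "r \<in> {q..rise e}" "(q', M') \<in> slots e'" "r' \<in> {q'..rise e'}"
      by simp_all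
    obtain u v w where
      1: "e = u @ v @ w" "length u = q" "length (u @ v) = r" "\<And>x. x \<in> set (u @ v @ w) \<Longrightarrow> x < M"
        "insert_two (e, (q, M), r) = u @ M # v @ M # w"
      using slots_split_two[OF s(1,2)] by metis
    obtain u' v' w' where
      2: "e' = u' @ v' @ w'" "length u' = q'" "length (u' @ v') = r'" "\<forall>x\<in>set (u' @ v' @ w'). x < M'"
        "insert_two (e', (q', M'), r') = u' @ M' # v' @ M' # w'"
      using slots_split_two[OF s(3,4)] by metis
    have eq': "u @ M # v @ M # w = u' @ M' # v' @ M' # w'"
      using eq unfolding 1(5) 2(5) .
    have "Max (set (u @ M # v @ M # w)) = M" "Max (set (u' @ M' # v' @ M' # w')) = M'"
      by (intro Max_insert_two 1(4)[rule_format] 2(4)[rule_format]; assumption)+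
    with eq' have M: "M' = M"
      by simp
    have "M \<notin> set u" "M \<notin> set u'" "M \<notin> set v" "M \<notin> set v'"
      using 1(4) 2(4) by (auto simp: M)
    with eq' have "u = u' \<and> v = v' \<and> w = w'"
      unfolding M by (simp add: append_Cons_unique)
    with 1 2 M show "x = x'"
      by (simp add: x)
  qed
next
  fix f assume "f \<in> insert_two ` (SIGMA e:admissible_dist m. SIGMA s:slots e. {fst s..rise e})"
  then obtain e q M r where e: "e \<in> admissible_dist m" and s: "(q, M) \<in> slots e" "r \<in> {q..rise e}"
    and f: "f = insert_two (e, (q, M), r)"
    by auto
  obtain u v w where *: "e = u @ v @ w" "length u = q" "sorted (u @ v)" "M \<le> q"
    "\<forall>x\<in>set (u @ v @ w). x < M" "insert_two (e, (q, M), r) = u @ M # v @ M # w"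
    using slots_split_two[OF s] by metis
  have M: "M \<notin> set (u @ v @ w)"
    using *(5) by blast
  have less: "x < M" if "x \<in> set (u @ v @ w)" for x
    using *(5) that by blast
  have adm: "admissible (u @ M # v @ M # w) \<longleftrightarrow> admissible (u @ v @ w) \<and> sorted (u @ v) \<and> M \<le> length u"
    by (rule admissible_insert_two) (rule less)
  have Max: "Max (set (u @ M # v @ M # w)) = M"
    by (rule Max_insert_two) (rule less)
  have "admissible f"
    unfolding f *(6) adm using e *(1-4) by (simp add: admissible_dist_def)
  moreover have "card (set f) = Suc m"
    unfolding f *(6) using e M by (simp add: *(1) admissible_dist_def)
  moreover have "count_list f (Max (set f)) = 2"
    unfolding f *(6) Max using M by (simp add: count_list_0_iff)
  ultimately show "f \<in> {e \<in> admissible_dist (Suc m). count_list e (Max (set e)) = 2}"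
    by (simp add: admissible_dist_def)
next
  fix f assume *: "f \<in> {e \<in> admissible_dist (Suc m). count_list e (Max (set e)) = 2}"
  define M where "M = Max (set f)"
  have count: "count_list f M = 2"
    using * by (simp add: M_def)
  have "f \<noteq> []"
    using * by (auto simp: admissible_dist_def)
  then have "M \<in> set f" and le: "\<And>x. x \<in> set f \<Longrightarrow> x \<le> M"
    by (simp_all add: M_def)
  \<comment> \<open>Splitting at the first occurrence leaves exactly one copy of \<open>M\<close> in
    \<open>v'\<close>.\<close>
  then obtain u v' where f': "f = u @ M # v'" and u: "M \<notin> set u"
    by (metis split_list_first)
  have "count_list u M = 0"
    using u unfolding count_list_0_iff .
  then have "count_list v' M = 1"
    using count by (simp add: f')
  then have "M \<in> set v'"
    using count_list_0_iff[of v' M] by auto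
  then obtain v w where v': "v' = v @ M # w"
    by (auto dest: split_list)
  note f = f'[unfolded v']
  have "count_list (u @ v @ w) M = 0"
    using \<open>count_list v' M = 1\<close> \<open>count_list u M = 0\<close> by (simp add: v')
  then have M: "M \<notin> set (u @ v @ w)"
    unfolding count_list_0_iff .
  have less: "x < M" if "x \<in> set (u @ v @ w)" for x
    using le[of x] that M by (cases "x = M") (auto simp: f)
  have adm: "admissible (u @ v @ w)" "sorted (u @ v)" "M \<le> length u"
    using admissible_insert_two[OF less] * by (simp_all add: f admissible_dist_def)
  have "card (set (u @ v @ w)) = m"
    using * M by (simp add: f admissible_dist_def)
  with adm have "u @ v @ w \<in> admissible_dist m"
    by (simp add: admissible_dist_def)
  moreover have "(length u, M) \<in> slots (u @ v @ w)"
    using adm less by (auto simp: slots_def le_rise_iff bound_le_iff sorted_append)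
  moreover have "length (u @ v) \<in> {fst (length u, M)..rise (u @ v @ w)}"
    using adm by (simp add: le_rise_iff)
  moreover have "f = insert_two (u @ v @ w, (length u, M), length (u @ v))"
    by (simp add: f insert_two_def)
  ultimately show "f \<in> insert_two ` (SIGMA e:admissible_dist m. SIGMA s:slots e. {fst s..rise e})"
    by blast
qed

section \<open>Counting\<close>

lemma finite_slots: "finite (slots e)"
  by (rule finite_subset[of _ "{..rise e} \<times> {..rise e}"]) (auto simp: slots_def)

text \<open>In the coordinates \<open>s = q - M\<close> and \<open>i = rise e - q\<close>, the
  condition \<open>bound e \<le> M\<close> becomes \<open>s + i \<le> gap e\<close>, so the slots
  form a triangle.\<close>

lemma sum_slots:
  fixes F :: "nat \<Rightarrow> nat \<Rightarrow> nat"
  assumes "bound e \<le> rise e"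
  shows "(\<Sum>(q, M)\<in>slots e. F (rise e - q) (q - M)) = (\<Sum>s\<le>gap e. \<Sum>i\<le>gap e - s. F i s)"
  unfolding sum.Sigma[OF finite_atMost ballI[OF finite_atMost]]
  by (rule sum.reindex_bij_witness[of _ "\<lambda>(s, i). (rise e - i, rise e - i - s)" "\<lambda>(q, M). (q - M, rise e - q)"])
    (use assms in \<open>auto simp: slots_def gap_def\<close>)

lemma admissible_dist_Suc:
  "admissible_dist (Suc m) =
     {e \<in> admissible_dist (Suc m). count_list e (Max (set e)) = 1} \<union>
     {e \<in> admissible_dist (Suc m). count_list e (Max (set e)) = 2}"
proof -
  have "count_list e (Max (set e)) \<in> {1, 2}" if e: "e \<in> admissible_dist (Suc m)" for e
  proof -
    have "e \<noteq> []"
      using e by (auto simp: admissible_dist_def)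
    then have "Max (set e) \<in> set e"
      by simp
    then have "count_list e (Max (set e)) \<noteq> 0"
      by (simp add: count_list_0_iff)
    moreover have "count_list e (Max (set e)) \<le> 2"
      using e by (simp add: admissible_dist_def admissible_iff)
    ultimately show ?thesis
      by auto
  qed
  then show ?thesis
    by auto
qed

lemma admissible_dist_0: "admissible_dist 0 = {[]}"
  by (auto simp: admissible_dist_def admissible_iff inversion_sequence_def contains_102_def)

lemma finite_admissible_dist: "finite (admissible_dist m)"
proof (induction m)
  case (Suc m)
  then have "finite (SIGMA e:admissible_dist m. slots e)"
    "finite (SIGMA e:admissible_dist m. SIGMA s:slots e. {fst s..rise e})"
    by (simp_all add: finite_slots)
  then show ?case
    unfolding bij_betw_finite[OF bij_betw_insert_one] bij_betw_finite[OF bij_betw_insert_two]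
    by (subst admissible_dist_Suc) (rule finite_UnI)
qed (simp add: admissible_dist_0)

text \<open>A word with at least one entry arises by an insertion, and both insertions yield the
  inequality; the empty word has bound \<open>0\<close>.\<close>

lemma bound_le_rise:
  assumes "e \<in> admissible_dist m"
  shows "bound e \<le> rise e"
proof (cases m)
  case 0
  with assms show ?thesis
    by (simp add: admissible_dist_0 bound_def)
next
  case (Suc n)
  with assms have "e \<in> insert_one ` (SIGMA e:admissible_dist n. slots e) \<union>
      insert_two ` (SIGMA e:admissible_dist n. SIGMA s:slots e. {fst s..rise e})"
    unfolding bij_betw_imp_surj_on[OF bij_betw_insert_one] bij_betw_imp_surj_on[OF bij_betw_insert_two]
    using admissible_dist_Suc by blast
  then show ?thesis
    using gap_insert_one(2) gap_insert_two(2) by fastforce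
qed

text \<open>The arbitrary weight \<open>h\<close> records the whole distribution of gaps. With
  \<open>s = q - M\<close>, a slot yields one word by single insertion and
  \<open>Suc (rise e - q)\<close> by double insertion; all have gap \<open>s\<close>, except that
  two adjacent copies give \<open>Suc s\<close>.\<close>

lemma sum_admissible_dist_Suc:
  fixes h :: "nat \<Rightarrow> nat"
  shows "(\<Sum>e\<in>admissible_dist (Suc m). h (gap e)) = (\<Sum>e\<in>admissible_dist m.
    \<Sum>s\<le>gap e. ((gap e - s + 2) choose 2) * h s + Suc (gap e - s) * h (Suc s))"
proof -
  let ?S1 = "SIGMA e:admissible_dist m. slots e"
  let ?S2 = "SIGMA e:admissible_dist m. SIGMA s:slots e. {fst s..rise e}"
  have "(\<Sum>e\<in>admissible_dist (Suc m). h (gap e)) =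
      (\<Sum>e | e \<in> admissible_dist (Suc m) \<and> count_list e (Max (set e)) = 1. h (gap e)) +
      (\<Sum>e | e \<in> admissible_dist (Suc m) \<and> count_list e (Max (set e)) = 2. h (gap e))"
    by (subst admissible_dist_Suc, rule sum.union_disjoint) (auto simp: finite_admissible_dist)
  also have "\<dots> = (\<Sum>x\<in>?S1. h (gap (insert_one x))) + (\<Sum>x\<in>?S2. h (gap (insert_two x)))"
    by (simp only: sum.reindex_bij_betw[OF bij_betw_insert_one, symmetric]
        sum.reindex_bij_betw[OF bij_betw_insert_two, symmetric])
  also have "(\<Sum>x\<in>?S1. h (gap (insert_one x))) =
      (\<Sum>e\<in>admissible_dist m. \<Sum>s\<in>slots e. h (gap (insert_one (e, s))))"
    by (subst sum.Sigma) (auto simp: finite_admissible_dist finite_slots)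
  also have "(\<Sum>x\<in>?S2. h (gap (insert_two x))) =
      (\<Sum>e\<in>admissible_dist m. \<Sum>s\<in>slots e. \<Sum>r\<in>{fst s..rise e}. h (gap (insert_two (e, s, r))))"
    by (simp add: sum.Sigma finite_admissible_dist finite_slots split_def)
  also have "(\<Sum>e\<in>admissible_dist m. \<Sum>s\<in>slots e. h (gap (insert_one (e, s)))) + \<dots> =
      (\<Sum>e\<in>admissible_dist m. \<Sum>s\<in>slots e. h (gap (insert_one (e, s))) +
        (\<Sum>r\<in>{fst s..rise e}. h (gap (insert_two (e, s, r)))))"
    by (simp only: sum.distrib)
  also have "\<dots> = (\<Sum>e\<in>admissible_dist m.
      \<Sum>s\<le>gap e. ((gap e - s + 2) choose 2) * h s + Suc (gap e - s) * h (Suc s))"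
  proof (rule sum.cong[OF refl])
    fix e assume e: "e \<in> admissible_dist m"
    have "(\<Sum>s\<in>slots e. h (gap (insert_one (e, s))) + (\<Sum>r\<in>{fst s..rise e}. h (gap (insert_two (e, s, r))))) =
        (\<Sum>(q, M)\<in>slots e. Suc (rise e - q) * h (q - M) + h (Suc (q - M)))"
    proof (rule sum.cong[OF refl])
      fix s assume s: "s \<in> slots e"
      obtain q M where qM: "s = (q, M)"
        by fastforce
      have q: "q \<le> rise e"
        using s by (simp add: slots_def qM)
      have "(\<Sum>r\<in>{q..rise e}. h (gap (insert_two (e, (q, M), r)))) =
          (\<Sum>r\<in>{q..rise e}. if r = q then h (Suc (q - M)) else h (q - M))"
        using s by (intro sum.cong refl) (simp add: gap_insert_two qM)
      also have "\<dots> = h (Suc (q - M)) + (rise e - q) * h (q - M)"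
        using q by (simp add: sum.atLeast_Suc_atMost)
      finally show "h (gap (insert_one (e, s))) + (\<Sum>r\<in>{fst s..rise e}. h (gap (insert_two (e, s, r)))) =
          (case s of (q, M) \<Rightarrow> Suc (rise e - q) * h (q - M) + h (Suc (q - M)))"
        using s by (simp add: qM gap_insert_one)
    qed
    also have "\<dots> = (\<Sum>s\<le>gap e. \<Sum>i\<le>gap e - s. Suc i * h s + h (Suc s))"
      by (rule sum_slots[OF bound_le_rise[OF e]])
    also have "\<dots> = (\<Sum>s\<le>gap e. ((gap e - s + 2) choose 2) * h s + Suc (gap e - s) * h (Suc s))"
      by (simp only: sum.distrib sum_distrib_right[symmetric] sum_Suc_atMost) simp
    finally show "(\<Sum>s\<in>slots e. h (gap (insert_one (e, s))) +
        (\<Sum>r\<in>{fst s..rise e}. h (gap (insert_two (e, s, r))))) =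
        (\<Sum>s\<le>gap e. ((gap e - s + 2) choose 2) * h s + Suc (gap e - s) * h (Suc s))" .
  qed
  finally show ?thesis .
qed

lemma sum_gap_admissible_dist:
  fixes h :: "nat \<Rightarrow> nat"
  shows "(\<Sum>e\<in>admissible_dist m. h (gap e)) = (\<Sum>s\<le>m. ballot (m - s) (3 * s + 1) * h s)"
proof (induction m arbitrary: h)
  case 0
  have "gap [] = 0"
    by (simp add: gap_def rise_append[of "[]" "[]", simplified])
  then show ?case
    by (simp add: admissible_dist_0)
next
  case (Suc m)
  \<comment> \<open>The hypothesis holds for every weight, in particular for the one that sends a
    gap to the total contribution of the children.\<close>
  show ?case
    unfolding sum_admissible_dist_Suc
      Suc[of "\<lambda>g. \<Sum>s\<le>g. ((g - s + 2) choose 2) * h s + Suc (g - s) * h (Suc s)"]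
    by (rule ballot_transfer)
qed

lemma card_unique_max:
  "card {e \<in> admissible_dist (Suc m). count_list e (Max (set e)) = 1} = ballot (Suc m) 1"
proof -
  have "card {e \<in> admissible_dist (Suc m). count_list e (Max (set e)) = 1} =
      card (SIGMA e:admissible_dist m. slots e)"
    by (rule bij_betw_same_card[OF bij_betw_insert_one, symmetric])
  also have "\<dots> = (\<Sum>e\<in>admissible_dist m. card (slots e))"
    by (simp add: card_SigmaI finite_admissible_dist finite_slots)
  also have "\<dots> = (\<Sum>e\<in>admissible_dist m. (gap e + 2) choose 2)"
  proof (rule sum.cong[OF refl])
    fix e assume e: "e \<in> admissible_dist m"
    show "card (slots e) = (gap e + 2) choose 2"
      using sum_slots[OF bound_le_rise[OF e], of "\<lambda>_ _. 1"] sum_Suc_diff[of "gap e"] by simp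
  qed
  also have "\<dots> = (\<Sum>s\<le>m. ((s + 2) choose 2) * ballot (m - s) (3 * s + 1))"
    by (simp only: sum_gap_admissible_dist[of "\<lambda>g. (g + 2) choose 2"] mult.commute)
  \<comment> \<open>The convolution with \<open>r = 2\<close> and \<open>k = 1\<close> gives
    \<open>ballot m 4\<close>, which is \<open>ballot (Suc m) 1\<close> because
    \<open>ballot (Suc m) 0 = 0\<close>.\<close>
  also have "\<dots> = ballot (Suc m) 1"
    unfolding sum_choose_ballot by (simp add: numeral_eq_Suc)
  finally show ?thesis .
qed

theorem theorem3p4:
  fixes m :: nat
  assumes "m \<ge> 1"
  shows "real (card {e. inversion_sequence e \<and> avoids_102_000 e \<and> dist_entries e = m \<and>
                        card {p. p < length e \<and> e ! p = max_entry e} = 1})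
         = 1 / real (3 * m + 1) * real ((4 * m) choose m)"
proof -
  obtain n where m: "m = Suc n"
    using assms by (cases m) simp_all
  have "card {p. p < length e \<and> e ! p = max_entry e} = count_list e (Max (set e))" for e
    unfolding max_entry_def count_list_eq_length_filter length_filter_conv_card
    by (simp only: eq_commute)
  then have "{e. inversion_sequence e \<and> avoids_102_000 e \<and> dist_entries e = m \<and>
      card {p. p < length e \<and> e ! p = max_entry e} = 1} =
      {e \<in> admissible_dist m. count_list e (Max (set e)) = 1}"
    by (simp add: admissible_dist_def admissible_def dist_entries_def conj_assoc)
  then have "card {e. inversion_sequence e \<and> avoids_102_000 e \<and> dist_entries e = m \<and>
      card {p. p < length e \<and> e ! p = max_entry e} = 1} = ballot m 1"
    by (simp only: card_unique_max m)
  then show ?thesis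
    by (simp only: ballot_one)
qed

end
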